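(* For every $c\in\mathbb{R}$ and $T>0$, $\widetilde{B}^2_{c,T}\subset B^2_{c,T}$.
   Context: $\mathbb{R}^+=(0,\infty)$, $\Omega=\mathbb{C}\setminus[0,\infty)$. For $c\in\mathbb{R}$, $X^2_c$ is the space of measurable $f:\mathbb{R}^+\to\mathbb{C}$ with $f(x)x^{c-1/2}\in L^2(\mathbb{R}^+)$. For $f\in X^2_c$ the Mellin transform $[f]^\wedge_{M^2}(c+it)$, $t\in\mathbb{R}$, is the $L^2(\mathbb{R})$-limit as $\rho\to\infty$ of $\int_{1/\rho}^{\rho} f(u)u^{c+it-1}\,du$. $B^2_{c,T}$ is the set of $f\in X^2_c\cap C(\mathbb{R}^+)$ such that $[f]^\wedge_{M^2}(c+it)=0$ for almost every $|t|>T$. The Mellin–Bernstein space $\widetilde{B}^2_{c,T}$ consists of all $f\in X^2_c$ such that $g(x):=x^cf(x)$ has an analytic extension to the Riemann surface of the logarithm, given by analytic branches $g_k:\Omega\to\mathbb{C}$, $k\in\mathbb{Z}$, with: (i) for every $x>0$ the limits $g_k^+(x)=\lim_{\varepsilon\to0^+}g_k(x+i\varepsilon)$ and $g_k^-(x)=\lim_{\varepsilon\to0^+}g_k(x-i\varepsilon)$ exist, $g_k^-(x)=g_{k+1}^+(x)$, and $g_0^+(x)=g(x)$; (ii) for every $x>0$ and every open disk $U_x$ in the right half-plane centered at $x$, the function $\psi_k:U_x\to\mathbb{C}$ equal to $g_k(z)$ for $\Im z<0$, to $g_k^-(z)$ for $z\in U_x\cap\mathbb{R}$, and to $g_{k+1}(z)$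 for $\Im z>0$, is analytic; (iii) there is $C>0$ such that $|g_k(re^{i\theta})|\le Ce^{T|2\pi k+\theta|}$ for all $k\in\mathbb{Z}$, $\theta\in[0,2\pi]$, $r>0$; (iv) for each $k$, $\lim_{r\to0}g_k(re^{i\theta})=\lim_{r\to\infty}g_k(re^{i\theta})=0$ uniformly in $\theta\in[0,2\pi]$. In (iii) and (iv), $g_k(re^{i0})$ means $g_k^+(r)$ and $g_k(re^{2\pi i})$ means $g_k^-(r)$. *)

theory Defs
  imports "HOL-Analysis.Analysis"
begin

definition X2 :: "real \<Rightarrow> (real \<Rightarrow> complex) set" where
  "X2 c = {f. set_borel_measurable lborel {0<..} f \<and>
              set_integrable lborel {0<..} (\<lambda>x. (cmod (f x * of_real (x powr (c - 1/2))))\<^sup>2)}"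

definition mellin_trunc :: "(real \<Rightarrow> complex) \<Rightarrow> real \<Rightarrow> real \<Rightarrow> real \<Rightarrow> complex" where
  "mellin_trunc f c \<rho> t =
     (LINT u:{1/\<rho>..\<rho>}|lborel. f u * (of_real u) powr (of_real c + \<i> * of_real t - 1))"

text \<open>M is (a representative of) the L^2 Mellin transform [f]^M2(c+it), as function of t:
  the L^2(R)-limit of the truncated integrals as rho tends to infinity.\<close>
definition is_mellin_L2 :: "(real \<Rightarrow> complex) \<Rightarrow> real \<Rightarrow> (real \<Rightarrow> complex) \<Rightarrow> bool" where
  "is_mellin_L2 f c M \<longleftrightarrow>
     M \<in> borel_measurable lborel \<and>
     integrable lborel (\<lambda>t. (cmod (M t))\<^sup>2) \<and>
     (\<forall>\<^sub>F \<rho> in at_top. integrable lborel (\<lambda>t. (cmod (mellin_trunc f c \<rho> t - M t))\<^sup>2)) \<and>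
     ((\<lambda>\<rho>. LINT t|lborel. (cmod (mellin_trunc f c \<rho> t - M t))\<^sup>2) \<longlongrightarrow> 0) at_top"

definition B2 :: "real \<Rightarrow> real \<Rightarrow> (real \<Rightarrow> complex) set" where
  "B2 c T = {f. f \<in> X2 c \<and> continuous_on {0<..} f \<and>
              (\<exists>M. is_mellin_L2 f c M \<and> (AE t in lborel. \<bar>t\<bar> > T \<longrightarrow> M t = 0))}"

definition Omega :: "complex set" where
  "Omega = - (complex_of_real ` {0..})"

definition branch_val ::
  "(int \<Rightarrow> complex \<Rightarrow> complex) \<Rightarrow> (int \<Rightarrow> real \<Rightarrow> complex) \<Rightarrow> (int \<Rightarrow> real \<Rightarrow> complex)
   \<Rightarrow> int \<Rightarrow> real \<Rightarrow> real \<Rightarrow> complex" where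
  "branch_val G gp gm k r \<theta> =
     (if \<theta> = 0 then gp k r else if \<theta> = 2 * pi then gm k r else G k (of_real r * cis \<theta>))"

definition glued ::
  "(int \<Rightarrow> complex \<Rightarrow> complex) \<Rightarrow> (int \<Rightarrow> real \<Rightarrow> complex) \<Rightarrow> int \<Rightarrow> complex \<Rightarrow> complex" where
  "glued G gm k z = (if Im z < 0 then G k z else if Im z = 0 then gm k (Re z) else G (k + 1) z)"

definition MB2 :: "real \<Rightarrow> real \<Rightarrow> (real \<Rightarrow> complex) set" where
  "MB2 c T = {f. f \<in> X2 c \<and>
     (\<exists>(G :: int \<Rightarrow> complex \<Rightarrow> complex) (gp :: int \<Rightarrow> real \<Rightarrow> complex) (gm :: int \<Rightarrow> real \<Rightarrow> complex).
        (\<forall>k. G k analytic_on Omega) \<and>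
        \<comment> \<open>(i)\<close>
        (\<forall>k. \<forall>x>0. ((\<lambda>\<epsilon>. G k (of_real x + \<i> * of_real \<epsilon>)) \<longlongrightarrow> gp k x) (at_right 0)) \<and>
        (\<forall>k. \<forall>x>0. ((\<lambda>\<epsilon>. G k (of_real x - \<i> * of_real \<epsilon>)) \<longlongrightarrow> gm k x) (at_right 0)) \<and>
        (\<forall>k. \<forall>x>0. gm k x = gp (k + 1) x) \<and>
        (\<forall>x>0. gp 0 x = of_real (x powr c) * f x) \<and>
        \<comment> \<open>(ii)\<close>
        (\<forall>k. \<forall>x>0. \<forall>r. 0 < r \<and> r \<le> x \<longrightarrow> glued G gm k analytic_on ball (of_real x) r) \<and>
        \<comment> \<open>(iii)\<close>
        (\<exists>C>0. \<forall>k. \<forall>\<theta>\<in>{0..2*pi}. \<forall>r>0.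
            cmod (branch_val G gp gm k r \<theta>) \<le> C * exp (T * \<bar>2 * pi * of_int k + \<theta>\<bar>)) \<and>
        \<comment> \<open>(iv)\<close>
        (\<forall>k. uniform_limit {0..2*pi} (\<lambda>r \<theta>. branch_val G gp gm k r \<theta>) (\<lambda>_. 0) (at_right 0)) \<and>
        (\<forall>k. uniform_limit {0..2*pi} (\<lambda>r \<theta>. branch_val G gp gm k r \<theta>) (\<lambda>_. 0) at_top))}"

end

(* With w = log z the branches glue to an entire function F with |F w| \<le> C exp (T |Im w|) that
   tends to 0 at both ends of every horizontal line, and the truncated Mellin integrals become
   the integrals of F s exp (i t s) over s from -R to R, where R = ln rho. For t > T (t < -T) the segment
   can be pushed up (down) to infinity; only the vertical sides survive, and they vanish as R
   grows by dominated convergence, so the truncated integrals tend to 0 pointwise for |t| > T.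
   By the Plancherel inequality, proved with a Gaussian weight, they are also Cauchy in L^2.
   Their L^2 limit exists and is the pointwise limit along a subsequence, hence 0 for |t| > T. *)
theory Submission
  imports
    Defs
    "HOL-Probability.Probability"
    "HOL-Complex_Analysis.Complex_Analysis"
    "HOL-Real_Asymp.Real_Asymp"
begin

text \<open>On the real line F is known to be square integrable, but perhaps not integrable. So two
  modes of convergence meet on the truncations: shifting the segment treats each t with |t| > T
  separately, while the Mellin transform is a mean-square limit over all t. The decay in (iv) is
  uniform only on one sheet at a time, so it does not control a whole vertical side; the factor exp
  (-(t - T) y) supplies the missing majorant over all heights. The standard normal law enters twice,
  for different reasons. In the Plancherel inequality it makes the integral over t converge
  absolutely, so that Fubini applies before the weight is removed. Later it replaces Lebesgue
  measure by a probability measure with the same null sets, on which bounded transforms are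
  integrable and L^2 bounds give L^1 bounds.\<close>

subsection \<open>Plancherel inequality\<close>

lemma borel_measurable_cnj [measurable]: "cnj \<in> borel_measurable borel"
  by (intro borel_measurable_continuous_onI continuous_intros)

text \<open>Up to the stated factor, the kernel is the normal density with mean \<open>a\<close> and
  standard deviation \<open>1 / \<sigma>\<close>, whose mass is 1.\<close>

lemma nn_integral_gaussian_kernel:
  fixes a \<sigma> :: real
  assumes "\<sigma> > 0"
  shows "(\<integral>\<^sup>+y. ennreal (exp (- (\<sigma> * (a - y))\<^sup>2 / 2)) \<partial>lborel) = ennreal (sqrt (2 * pi) / \<sigma>)"
proof -
  have eq: "exp (- (\<sigma> * (a - y))\<^sup>2 / 2) = sqrt (2 * pi) / \<sigma> * normal_density a (1 / \<sigma>) y" for y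
  proof -
    have 1: "(y - a)\<^sup>2 / (2 * (1 / \<sigma>)\<^sup>2) = (\<sigma> * (a - y))\<^sup>2 / 2"
      using assms by (simp add: field_simps power2_eq_square)
    have 2: "sqrt (2 * pi * (1 / \<sigma>)\<^sup>2) = sqrt (2 * pi) / \<sigma>"
      using assms by (simp add: real_sqrt_mult real_sqrt_divide)
    show ?thesis
      unfolding normal_density_def minus_divide_left[symmetric] 1 2 using assms by simp
  qed
  have "(\<integral>\<^sup>+y. ennreal (exp (- (\<sigma> * (a - y))\<^sup>2 / 2)) \<partial>lborel)
      = ennreal (sqrt (2 * pi) / \<sigma>) * (\<integral>\<^sup>+y. ennreal (normal_density a (1 / \<sigma>) y) \<partial>lborel)"
    unfolding eq using assms
    by (subst nn_integral_cmult[symmetric]) (simp_all add: ennreal_mult del: times_divide_eq_left)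
  also have "(\<integral>\<^sup>+y. ennreal (normal_density a (1 / \<sigma>) y) \<partial>lborel) = 1"
    using assms by (subst nn_integral_eq_integral) auto
  finally show ?thesis by simp
qed

text \<open>The positive sign matches u powr (i t) under u = exp s; without a normalising factor,
  Plancherel carries the constant 2 pi.\<close>

definition fourier :: "(real \<Rightarrow> complex) \<Rightarrow> real \<Rightarrow> complex" where
  "fourier \<phi> t = (LINT s|lborel. \<phi> s * iexp (t * s))"

lemma integrable_mult_iexp:
  fixes \<phi> :: "real \<Rightarrow> complex"
  assumes "integrable lborel \<phi>"
  shows "integrable lborel (\<lambda>s. \<phi> s * iexp (t * s))"
  by (rule Bochner_Integration.integrable_bound[OF assms]) (use assms in \<open>auto simp: norm_mult\<close>)

lemma borel_measurable_fourier [measurable]: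
  assumes [measurable]: "\<phi> \<in> borel_measurable borel"
  shows "fourier \<phi> \<in> borel_measurable borel"
  unfolding fourier_def by measurable

lemma norm_fourier_le:
  assumes "integrable lborel \<phi>"
  shows "cmod (fourier \<phi> t) \<le> (LINT s|lborel. cmod (\<phi> s))"
  unfolding fourier_def
  by (rule order_trans[OF integral_norm_bound]) (simp add: norm_mult)

lemma integrable_tensor_cnj:
  fixes \<phi> :: "real \<Rightarrow> complex"
  assumes i: "integrable lborel \<phi>"
  shows "integrable (lborel \<Otimes>\<^sub>M lborel) (\<lambda>(x, y). \<phi> x * cnj (\<phi> y))"
proof (rule lborel_pair.Fubini_integrable)
  have [measurable]: "\<phi> \<in> borel_measurable borel" using i by simp
  show "(\<lambda>(x, y). \<phi> x * cnj (\<phi> y)) \<in> borel_measurable (lborel \<Otimes>\<^sub>M lborel)"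
    by (simp add: split_beta')
qed (use i in \<open>simp_all add: norm_mult\<close>)

text \<open>As an integral over the plane, the square involves \<open>t\<close> only in a character
  of \<open>fst p - snd p\<close>, so averaging over \<open>t\<close> acts on that factor
  alone.\<close>

lemma fourier_norm_square:
  assumes i: "integrable lborel \<phi>"
  shows "complex_of_real ((cmod (fourier \<phi> t))\<^sup>2) =
    (LINT p|(lborel \<Otimes>\<^sub>M lborel). \<phi> (fst p) * cnj (\<phi> (snd p)) * iexp (t * (fst p - snd p)))"
proof -
  have [measurable]: "\<phi> \<in> borel_measurable borel" using i by simp
  define \<psi> where "\<psi> s = \<phi> s * iexp (t * s)" for s
  have i': "integrable lborel \<psi>"
    unfolding \<psi>_def by (rule integrable_mult_iexp[OF i])
  have eq: "\<phi> x * cnj (\<phi> y) * iexp (t * (x - y)) = \<psi> x * cnj (\<psi> y)" for x y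
    by (simp add: \<psi>_def exp_cnj flip: exp_add) (simp add: algebra_simps flip: exp_add exp_diff exp_minus)
  have "(LINT p|(lborel \<Otimes>\<^sub>M lborel). \<phi> (fst p) * cnj (\<phi> (snd p)) * iexp (t * (fst p - snd p)))
     = (LINT p|(lborel \<Otimes>\<^sub>M lborel). (\<lambda>(x, y). \<psi> x * cnj (\<psi> y)) p)"
    by (simp only: eq split_beta')
  also have "\<dots> = (LINT x|lborel. LINT y|lborel. \<psi> x * cnj (\<psi> y))"
    by (subst lborel_pair.integral_fst'[OF integrable_tensor_cnj[OF i'], symmetric]) simp
  also have "\<dots> = fourier \<phi> t * cnj (fourier \<phi> t)"
    by (simp add: fourier_def \<psi>_def del: complex_cnj_mult)
  finally show ?thesis
    by (simp only: complex_norm_square)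
qed

text \<open>A probability measure times an integrable function of \<open>p\<close> allows Fubini.
  The inner average of the character is then the characteristic function of the standard normal law
  at \<open>\<sigma> * (fst p - snd p)\<close>.\<close>

lemma fourier_gaussian_average:
  assumes i: "integrable lborel \<phi>"
  shows "(LINT x|std_normal_distribution. complex_of_real ((cmod (fourier \<phi> (\<sigma> * x)))\<^sup>2)) =
    (LINT p|(lborel \<Otimes>\<^sub>M lborel). \<phi> (fst p) * cnj (\<phi> (snd p)) *
       of_real (exp (- (\<sigma> * (fst p - snd p))\<^sup>2 / 2)))"
proof -
  have [measurable]: "\<phi> \<in> borel_measurable borel" using i by simp
  let ?N = std_normal_distribution
  let ?L = "lborel \<Otimes>\<^sub>M lborel :: (real \<times> real) measure"
  interpret N: real_distribution ?N by (rule real_dist_normal_dist)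
  interpret P: pair_sigma_finite ?N ?L
    by (intro pair_sigma_finite.intro N.sigma_finite_measure_axioms lborel_pair.sigma_finite_measure_axioms)
  define \<Phi> where "\<Phi> p = \<phi> (fst p) * cnj (\<phi> (snd p))" for p
  have i\<Phi>: "integrable ?L \<Phi>"
    using integrable_tensor_cnj[OF i] by (simp add: \<Phi>_def[abs_def] split_beta')
  then have [measurable]: "\<Phi> \<in> borel_measurable ?L" by simp
  have "integrable (?N \<Otimes>\<^sub>M ?L) (\<lambda>(x, p). \<Phi> p * iexp (\<sigma> * x * (fst p - snd p)))"
  proof (rule P.Fubini_integrable)
    show "(\<lambda>(x, p). \<Phi> p * iexp (\<sigma> * x * (fst p - snd p))) \<in> borel_measurable (?N \<Otimes>\<^sub>M ?L)"
      by measurable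
    have "integrable ?L (\<lambda>p. \<Phi> p * iexp (\<sigma> * x * (fst p - snd p)))" for x
      by (rule Bochner_Integration.integrable_bound[OF i\<Phi>]) (auto simp: norm_mult)
    then show "AE x in ?N. integrable ?L (\<lambda>p. (\<lambda>(x, p). \<Phi> p * iexp (\<sigma> * x * (fst p - snd p))) (x, p))"
      by simp
  qed (simp add: norm_mult)
  then have "(LINT p|?L. LINT x|?N. \<Phi> p * iexp (\<sigma> * x * (fst p - snd p)))
      = (LINT x|?N. LINT p|?L. \<Phi> p * iexp (\<sigma> * x * (fst p - snd p)))"
    by (rule P.Fubini_integral)
  moreover have "(LINT x|?N. \<Phi> p * iexp (\<sigma> * x * (fst p - snd p)))
      = \<Phi> p * of_real (exp (- (\<sigma> * (fst p - snd p))\<^sup>2 / 2))" for p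
  proof -
    have "(LINT x|?N. iexp (\<sigma> * x * (fst p - snd p))) = char ?N (\<sigma> * (fst p - snd p))"
      unfolding char_def by (intro Bochner_Integration.integral_cong) (simp_all add: mult_ac)
    then show ?thesis
      by (simp only: integral_mult_right_zero char_std_normal_distribution)
  qed
  ultimately show ?thesis
    by (simp only: fourier_norm_square[OF i] \<Phi>_def)
qed

text \<open>This is a Schur test: a b \<le> (a^2 + b^2) / 2 separates the two factors of
  \<open>\<phi>\<close>, and the remaining kernel has the same integral
  \<open>sqrt (2 * pi) / \<sigma>\<close> in either variable.\<close>

lemma fourier_gaussian_average_le:
  assumes i: "integrable lborel \<phi>" and \<sigma>: "\<sigma> > 0"
  shows "(\<integral>\<^sup>+x. ennreal ((cmod (fourier \<phi> (\<sigma> * x)))\<^sup>2) \<partial>std_normal_distribution)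
    \<le> ennreal (sqrt (2 * pi) / \<sigma>) * (\<integral>\<^sup>+s. ennreal ((cmod (\<phi> s))\<^sup>2) \<partial>lborel)"
proof -
  have [measurable]: "\<phi> \<in> borel_measurable borel" using i by simp
  let ?N = std_normal_distribution
  let ?L = "lborel \<Otimes>\<^sub>M lborel :: (real \<times> real) measure"
  interpret N: real_distribution ?N by (rule real_dist_normal_dist)
  define K where "K x y = exp (- (\<sigma> * (x - y))\<^sup>2 / 2)" for x y
  define A where "A = (\<integral>\<^sup>+s. ennreal ((cmod (\<phi> s))\<^sup>2) \<partial>lborel)"
  define B where "B = (LINT s|lborel. cmod (\<phi> s))"
  have [measurable]: "(\<lambda>p. K (fst p) (snd p)) \<in> borel_measurable ?L"
    "K x \<in> borel_measurable borel" "(\<lambda>x. K x y) \<in> borel_measurable borel" for x y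
    unfolding K_def by measurable
  have K1: "(\<integral>\<^sup>+y. ennreal (K x y) \<partial>lborel) = ennreal (sqrt (2 * pi) / \<sigma>)" for x
    unfolding K_def by (rule nn_integral_gaussian_kernel[OF \<sigma>])
  have K2: "(\<integral>\<^sup>+x. ennreal (K x y) \<partial>lborel) = ennreal (sqrt (2 * pi) / \<sigma>)" for y
    using K1[of y] by (simp add: K_def power_mult_distrib power2_commute[of _ y])
  have "integrable ?N (\<lambda>x. (cmod (fourier \<phi> (\<sigma> * x)))\<^sup>2)"
    by (rule N.integrable_const_bound[where B = "B\<^sup>2"])
       (auto intro!: power_mono norm_fourier_le[OF i] simp: B_def)
  then have "(\<integral>\<^sup>+x. ennreal ((cmod (fourier \<phi> (\<sigma> * x)))\<^sup>2) \<partial>?N)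
      = ennreal (LINT x|?N. (cmod (fourier \<phi> (\<sigma> * x)))\<^sup>2)"
    by (intro nn_integral_eq_integral) auto
  also have "\<dots> = ennreal (norm (LINT x|?N. complex_of_real ((cmod (fourier \<phi> (\<sigma> * x)))\<^sup>2)))"
    unfolding integral_complex_of_real by (simp add: integral_nonneg_AE)
  also have "\<dots> = ennreal (norm (LINT p|?L. \<phi> (fst p) * cnj (\<phi> (snd p)) * of_real (K (fst p) (snd p))))"
    by (simp only: fourier_gaussian_average[OF i] K_def)
  also have "\<dots> \<le> (\<integral>\<^sup>+p. norm (\<phi> (fst p) * cnj (\<phi> (snd p)) * of_real (K (fst p) (snd p))) \<partial>?L)"
  proof (rule integral_norm_bound_ennreal, rule Bochner_Integration.integrable_bound[OF integrable_tensor_cnj[OF i]])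
    show "AE p in ?L. norm (\<phi> (fst p) * cnj (\<phi> (snd p)) * of_real (K (fst p) (snd p)))
        \<le> norm (case p of (x, y) \<Rightarrow> \<phi> x * cnj (\<phi> y))"
      by (auto simp: norm_mult K_def split_beta' intro!: mult_left_le)
  qed measurable
  also have "\<dots> \<le> (\<integral>\<^sup>+p. ennreal (1 / 2) * (ennreal ((cmod (\<phi> (fst p)))\<^sup>2) * ennreal (K (fst p) (snd p)))
      + ennreal (1 / 2) * (ennreal ((cmod (\<phi> (snd p)))\<^sup>2) * ennreal (K (fst p) (snd p))) \<partial>?L)"
  proof (rule nn_integral_mono)
    fix p :: "real \<times> real"
    let ?a = "cmod (\<phi> (fst p))" and ?b = "cmod (\<phi> (snd p))" and ?K = "K (fst p) (snd p)"
    have K0: "?K \<ge> 0" by (simp add: K_def)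
    have "?a * ?b \<le> (?a\<^sup>2 + ?b\<^sup>2) / 2"
      using sum_squares_bound[of ?a ?b] by simp
    then have "?a * ?b * ?K \<le> (?a\<^sup>2 + ?b\<^sup>2) / 2 * ?K"
      using K0 by (rule mult_right_mono)
    then have "ennreal (?a * ?b * ?K) \<le> ennreal (1 / 2 * (?a\<^sup>2 * ?K) + 1 / 2 * (?b\<^sup>2 * ?K))"
      by (intro ennreal_leI) (simp add: field_simps)
    also have "\<dots> = ennreal (1 / 2) * (ennreal (?a\<^sup>2) * ennreal ?K) + ennreal (1 / 2) * (ennreal (?b\<^sup>2) * ennreal ?K)"
      using K0 by (simp only: ennreal_plus ennreal_mult' zero_le_power2 mult_nonneg_nonneg norm_ge_zero zero_le_divide_1_iff zero_le_numeral)
    finally show "ennreal (norm (\<phi> (fst p) * cnj (\<phi> (snd p)) * of_real ?K))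
       \<le> ennreal (1 / 2) * (ennreal (?a\<^sup>2) * ennreal ?K) + ennreal (1 / 2) * (ennreal (?b\<^sup>2) * ennreal ?K)"
      using K0 by (simp add: norm_mult)
  qed
  also have "\<dots> = ennreal (1 / 2) * (\<integral>\<^sup>+p. ennreal ((cmod (\<phi> (fst p)))\<^sup>2) * ennreal (K (fst p) (snd p)) \<partial>?L)
      + ennreal (1 / 2) * (\<integral>\<^sup>+p. ennreal ((cmod (\<phi> (snd p)))\<^sup>2) * ennreal (K (fst p) (snd p)) \<partial>?L)"
    by (subst nn_integral_add; (subst nn_integral_cmult)?; (subst nn_integral_cmult)?; measurable)
  also have "(\<integral>\<^sup>+p. ennreal ((cmod (\<phi> (fst p)))\<^sup>2) * ennreal (K (fst p) (snd p)) \<partial>?L)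
      = (\<integral>\<^sup>+x. \<integral>\<^sup>+y. ennreal ((cmod (\<phi> x))\<^sup>2) * ennreal (K x y) \<partial>lborel \<partial>lborel)"
    by (subst lborel.nn_integral_fst[symmetric]) auto
  also have "\<dots> = A * ennreal (sqrt (2 * pi) / \<sigma>)"
    by (simp add: nn_integral_cmult nn_integral_multc K1 A_def)
  also have "(\<integral>\<^sup>+p. ennreal ((cmod (\<phi> (snd p)))\<^sup>2) * ennreal (K (fst p) (snd p)) \<partial>?L)
      = (\<integral>\<^sup>+y. \<integral>\<^sup>+x. ennreal ((cmod (\<phi> y))\<^sup>2) * ennreal (K x y) \<partial>lborel \<partial>lborel)"
    by (subst lborel_pair.nn_integral_snd[symmetric]) (auto simp: split_beta')
  also have "\<dots> = A * ennreal (sqrt (2 * pi) / \<sigma>)"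
    by (simp add: nn_integral_cmult nn_integral_multc K2 A_def)
  finally have "(\<integral>\<^sup>+x. ennreal ((cmod (fourier \<phi> (\<sigma> * x)))\<^sup>2) \<partial>?N)
      \<le> (ennreal (1 / 2) + ennreal (1 / 2)) * (A * ennreal (sqrt (2 * pi) / \<sigma>))"
    by (simp only: distrib_right)
  also have "ennreal (1 / 2) + ennreal (1 / 2) = 1"
    by (subst ennreal_plus[symmetric]) auto
  finally show ?thesis by (simp add: A_def mult.commute)
qed

text \<open>The weighted integral is bounded independently of \<open>\<sigma>\<close>, and the
  weight tends to 1 as \<open>\<sigma>\<close> grows, so Fatou's lemma removes it. Working with
  nonnegative extended integrals covers the case of an infinite right-hand side.\<close>

lemma plancherel_le:
  assumes i: "integrable lborel \<phi>"
  shows "(\<integral>\<^sup>+t. ennreal ((cmod (fourier \<phi> t))\<^sup>2) \<partial>lborel)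
    \<le> ennreal (2 * pi) * (\<integral>\<^sup>+s. ennreal ((cmod (\<phi> s))\<^sup>2) \<partial>lborel)"
proof -
  have [measurable]: "\<phi> \<in> borel_measurable borel" using i by simp
  define A where "A = (\<integral>\<^sup>+s. ennreal ((cmod (\<phi> s))\<^sup>2) \<partial>lborel)"
  define q where "q \<sigma> t = ennreal ((cmod (fourier \<phi> t))\<^sup>2 * exp (- (t / \<sigma>)\<^sup>2 / 2))" for \<sigma> t
  have [measurable]: "q \<sigma> \<in> borel_measurable borel" for \<sigma>
    unfolding q_def by measurable
  have q_le: "(\<integral>\<^sup>+t. q \<sigma> t \<partial>lborel) \<le> ennreal (2 * pi) * A" if \<sigma>: "\<sigma> > 0" for \<sigma> :: real
  proof -
    \<comment> \<open>Substituting t = \<open>\<sigma> * x\<close> turns the weight into the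
      standard normal density up to \<open>sqrt (2 * pi)\<close>. The Jacobian
      \<open>\<sigma>\<close> later cancels the \<open>1 / \<sigma>\<close> of the Schur bound, and
      the two square roots multiply to \<open>2 * pi\<close>.\<close>
    have q_scale: "q \<sigma> (\<sigma> * x) = ennreal (sqrt (2 * pi)) *
        (ennreal (std_normal_density x) * ennreal ((cmod (fourier \<phi> (\<sigma> * x)))\<^sup>2))" for x
      unfolding q_def using \<sigma>
      by (subst ennreal_mult[symmetric], simp, simp, subst ennreal_mult[symmetric], simp, simp,
          intro arg_cong[where f = ennreal]) (simp add: std_normal_density_def)
    have "(\<integral>\<^sup>+t. q \<sigma> t \<partial>lborel) = ennreal \<sigma> * (\<integral>\<^sup>+x. q \<sigma> (\<sigma> * x) \<partial>lborel)"
      using nn_integral_real_affine[of "q \<sigma>" \<sigma> 0] \<sigma> by simp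
    also have "(\<integral>\<^sup>+x. q \<sigma> (\<sigma> * x) \<partial>lborel)
      = ennreal (sqrt (2 * pi)) * (\<integral>\<^sup>+x. ennreal ((cmod (fourier \<phi> (\<sigma> * x)))\<^sup>2) \<partial>std_normal_distribution)"
      unfolding q_scale by (subst nn_integral_density) (auto intro!: nn_integral_cmult)
    also have "ennreal \<sigma> * \<dots> \<le> ennreal \<sigma> * (ennreal (sqrt (2 * pi)) * (ennreal (sqrt (2 * pi) / \<sigma>) * A))"
      unfolding A_def by (intro mult_left_mono fourier_gaussian_average_le[OF i \<sigma>]) auto
    also have "\<dots> = ennreal (\<sigma> * sqrt (2 * pi) * (sqrt (2 * pi) / \<sigma>)) * A"
      using \<sigma> by (simp add: ennreal_mult mult.assoc del: times_divide_eq_right real_sqrt_mult)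
    also have "\<sigma> * sqrt (2 * pi) * (sqrt (2 * pi) / \<sigma>) = 2 * pi"
      using \<sigma> by (simp add: field_simps)
    finally show "(\<integral>\<^sup>+t. q \<sigma> t \<partial>lborel) \<le> ennreal (2 * pi) * A" .
  qed
  have lim: "(\<lambda>n. q (real (Suc n)) t) \<longlonglongrightarrow> ennreal ((cmod (fourier \<phi> t))\<^sup>2)" for t
  proof -
    have "(\<lambda>n. t / real (Suc n)) \<longlonglongrightarrow> 0"
      using LIMSEQ_Suc[OF lim_const_over_n[of t]] by simp
    then have "(\<lambda>n. (cmod (fourier \<phi> t))\<^sup>2 * exp (- (t / real (Suc n))\<^sup>2 / 2))
        \<longlonglongrightarrow> (cmod (fourier \<phi> t))\<^sup>2 * exp (- 0\<^sup>2 / 2)"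
      by (intro tendsto_intros) auto
    then show ?thesis unfolding q_def by (intro tendsto_ennrealI) simp
  qed
  have "(\<integral>\<^sup>+t. ennreal ((cmod (fourier \<phi> t))\<^sup>2) \<partial>lborel) = (\<integral>\<^sup>+t. liminf (\<lambda>n. q (real (Suc n)) t) \<partial>lborel)"
    by (intro nn_integral_cong) (use lim_imp_Liminf[OF _ lim] in simp)
  also have "\<dots> \<le> liminf (\<lambda>n. \<integral>\<^sup>+t. q (real (Suc n)) t \<partial>lborel)"
    by (rule nn_integral_liminf) measurable
  also have "\<dots> \<le> ennreal (2 * pi) * A"
    by (intro Liminf_le always_eventually allI q_le) simp_all
  finally show ?thesis by (simp add: A_def)
qed

subsection \<open>Fourier transforms in the mean\<close>

lemma fourier_diff:
  assumes "integrable lborel \<phi>" "integrable lborel \<psi>"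
  shows "fourier (\<lambda>s. \<phi> s - \<psi> s) t = fourier \<phi> t - fourier \<psi> t"
  using Bochner_Integration.integral_diff[OF assms[THEN integrable_mult_iexp], of t t]
  by (simp add: fourier_def left_diff_distrib)

text \<open>\<open>h\<close> will be the entire extension restricted to the real line: continuity
  makes each truncation integrable, and square integrability makes the tails vanish.\<close>

locale L2_continuous =
  fixes h :: "real \<Rightarrow> complex"
  assumes cont: "continuous_on UNIV h"
    and sq: "integrable lborel (\<lambda>s. (cmod (h s))\<^sup>2)"
begin

text \<open>A negative \<open>R\<close> is allowed and gives the zero function.\<close>

definition cut :: "real \<Rightarrow> real \<Rightarrow> complex" where
  "cut R s = indicator {-R..R} s *\<^sub>R h s"

definition tail :: "real \<Rightarrow> real" where
  "tail R = (LINT s|lborel. indicator (- {-R..R}) s *\<^sub>R (cmod (h s))\<^sup>2)"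

lemma h_measurable [measurable]: "h \<in> borel_measurable borel"
  by (rule borel_measurable_continuous_onI[OF cont])

lemma integrable_cut: "integrable lborel (cut R)"
  using borel_integrable_compact[of "{-R..R}" h] continuous_on_subset[OF cont, of "{-R..R}"]
  by (simp add: cut_def[abs_def])

lemma fourier_cut_measurable [measurable]: "fourier (cut R) \<in> borel_measurable borel"
  using integrable_cut[of R] by (intro borel_measurable_fourier) simp

lemma tail_integrable: "integrable lborel (\<lambda>s. indicator (- {-R..R}) s *\<^sub>R (cmod (h s))\<^sup>2)"
  by (rule Bochner_Integration.integrable_bound[OF sq]) (auto simp: indicator_def)

lemma tail_nonneg: "tail R \<ge> 0"
  unfolding tail_def by (intro integral_nonneg_AE) auto

lemma tail_tendsto_0: "(tail \<longlongrightarrow> 0) at_top"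
proof -
  have "(tail \<longlongrightarrow> (LINT s::real|lborel. (0::real))) at_top"
    unfolding tail_def[abs_def]
  proof (rule integral_dominated_convergence_at_top[OF _ _ sq])
    show "AE s in lborel. ((\<lambda>R. indicator (- {-R..R}) s *\<^sub>R (cmod (h s))\<^sup>2) \<longlongrightarrow> 0) at_top"
    proof (rule AE_I2)
      fix s :: real
      show "((\<lambda>R. indicator (- {-R..R}) s *\<^sub>R (cmod (h s))\<^sup>2) \<longlongrightarrow> 0) at_top"
        by (rule tendsto_eventually, rule eventually_mono[OF eventually_ge_at_top[of "\<bar>s\<bar>"]])
           (auto simp: indicator_def)
    qed
  qed (auto simp: indicator_def)
  then show ?thesis by simp
qed

text \<open>The difference of the cuts lives between the two cut-offs, where the tail beyond the
  smaller one dominates it. The bound is therefore uniform in \<open>R'\<close>, which Fatou's lemma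
  needs later.\<close>

lemma fourier_cut_diff_le:
  assumes "R \<le> R'"
  shows "(\<integral>\<^sup>+t. ennreal ((cmod (fourier (cut R) t - fourier (cut R') t))\<^sup>2) \<partial>lborel) \<le> ennreal (2 * pi * tail R)"
proof -
  have "(\<integral>\<^sup>+t. ennreal ((cmod (fourier (cut R) t - fourier (cut R') t))\<^sup>2) \<partial>lborel)
      = (\<integral>\<^sup>+t. ennreal ((cmod (fourier (\<lambda>s. cut R s - cut R' s) t))\<^sup>2) \<partial>lborel)"
    by (simp add: fourier_diff[OF integrable_cut integrable_cut])
  also have "\<dots> \<le> ennreal (2 * pi) * (\<integral>\<^sup>+s. ennreal ((cmod (cut R s - cut R' s))\<^sup>2) \<partial>lborel)"
    by (intro plancherel_le Bochner_Integration.integrable_diff integrable_cut)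
  also have "(\<integral>\<^sup>+s. ennreal ((cmod (cut R s - cut R' s))\<^sup>2) \<partial>lborel)
      \<le> (\<integral>\<^sup>+s. ennreal (indicator (- {-R..R}) s *\<^sub>R (cmod (h s))\<^sup>2) \<partial>lborel)"
    using assms by (intro nn_integral_mono ennreal_leI) (auto simp: cut_def indicator_def)
  also have "\<dots> = ennreal (tail R)"
    unfolding tail_def by (intro nn_integral_eq_integral tail_integrable) auto
  finally show ?thesis
    by (simp add: ennreal_mult tail_nonneg mult_left_mono)
qed

text \<open>An almost everywhere convergent subsequence will be drawn from an L^1 Cauchy sequence.
  Since the normal density is at most 1, the Lebesgue L^2 bound on differences passes to the normal
  law, whose finite mass then gives the L^1 bound.\<close>

lemma fourier_cut_gaussian_Cauchy:
  assumes "e > 0"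
  shows "\<exists>N. \<forall>i\<ge>N. \<forall>j\<ge>N.
    (LINT t|std_normal_distribution. cmod (fourier (cut (real i)) t - fourier (cut (real j)) t)) < e"
proof -
  let ?N = std_normal_distribution
  interpret N: real_distribution ?N by (rule real_dist_normal_dist)
  have dens_le: "std_normal_density t \<le> 1" for t
  proof -
    have "1 \<le> sqrt (2 * pi)" using pi_ge_two by simp
    moreover have "exp (- t\<^sup>2 / 2) \<le> 1" by simp
    ultimately have "exp (- t\<^sup>2 / 2) \<le> sqrt (2 * pi)" by linarith
    then show ?thesis
      unfolding std_normal_density_def by (simp add: divide_le_eq)
  qed
  have "((\<lambda>R. 2 * pi * tail R) \<longlongrightarrow> 2 * pi * 0) at_top"
    by (intro tendsto_intros tail_tendsto_0)
  then have "((\<lambda>n. 2 * pi * tail (real n)) \<longlongrightarrow> 0) sequentially"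
    using filterlim_compose[OF _ filterlim_real_sequentially] by fastforce
  then have "\<forall>\<^sub>F n in sequentially. 2 * pi * tail (real n) < e\<^sup>2"
    by (rule order_tendstoD) (use assms in simp)
  then obtain N where N: "\<And>n. n \<ge> N \<Longrightarrow> 2 * pi * tail (real n) < e\<^sup>2"
    by (auto simp: eventually_sequentially)
  have *: "(LINT t|?N. cmod (fourier (cut (real i)) t - fourier (cut (real j)) t)) < e"
    if "i \<ge> N" "i \<le> j" for i j
  proof -
    define d where "d t = cmod (fourier (cut (real i)) t - fourier (cut (real j)) t)" for t
    have [measurable]: "d \<in> borel_measurable borel"
      unfolding d_def[abs_def] by measurable
    define b where "b = (LINT s|lborel. cmod (cut (real i) s)) + (LINT s|lborel. cmod (cut (real j) s))"
    have d_le: "d t \<le> b" for t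
      unfolding d_def b_def
      by (rule order_trans[OF norm_triangle_ineq4]) (intro add_mono norm_fourier_le integrable_cut)
    have d0: "d t \<ge> 0" for t by (simp add: d_def)
    have i1: "integrable ?N d"
      by (rule N.integrable_const_bound[where B = b]) (auto simp: d_le d0)
    have i2: "integrable ?N (\<lambda>t. (d t)\<^sup>2)"
      by (rule N.integrable_const_bound[where B = "b\<^sup>2"]) (auto intro!: power_mono d_le d0)
    have "ennreal (LINT t|?N. (d t)\<^sup>2) = (\<integral>\<^sup>+t. ennreal ((d t)\<^sup>2) \<partial>?N)"
      by (rule nn_integral_eq_integral[OF i2, symmetric]) auto
    also have "\<dots> = (\<integral>\<^sup>+t. ennreal (std_normal_density t) * ennreal ((d t)\<^sup>2) \<partial>lborel)"
      by (subst nn_integral_density) auto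
    also have "\<dots> \<le> (\<integral>\<^sup>+t. ennreal ((d t)\<^sup>2) \<partial>lborel)"
    proof (rule nn_integral_mono)
      fix t
      show "ennreal (std_normal_density t) * ennreal ((d t)\<^sup>2) \<le> ennreal ((d t)\<^sup>2)"
        using mult_right_mono[OF dens_le, of "(d t)\<^sup>2" t]
        by (subst ennreal_mult[symmetric]) (auto intro!: ennreal_leI)
    qed
    also have "\<dots> \<le> ennreal (2 * pi * tail (real i))"
      unfolding d_def by (rule fourier_cut_diff_le) (use that in simp)
    finally have "(LINT t|?N. (d t)\<^sup>2) \<le> 2 * pi * tail (real i)"
      by (simp add: tail_nonneg)
    also have "\<dots> < e\<^sup>2" by (rule N[OF that(1)])
    finally have sq_less: "(LINT t|?N. (d t)\<^sup>2) < e\<^sup>2" .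
    \<comment> \<open>The inequality 2 e d \<le> e^2 + d^2 takes the place of
      Cauchy-Schwarz.\<close>
    have "(LINT t|?N. d t) \<le> (LINT t|?N. e / 2 + (d t)\<^sup>2 / (2 * e))"
    proof (rule integral_mono[OF i1])
      show "integrable ?N (\<lambda>t. e / 2 + (d t)\<^sup>2 / (2 * e))"
        using i2 by simp
      fix t
      show "d t \<le> e / 2 + (d t)\<^sup>2 / (2 * e)"
        using sum_squares_bound[of e "d t"] assms by (simp add: field_simps power2_eq_square)
    qed
    also have "\<dots> = e / 2 + (LINT t|?N. (d t)\<^sup>2) / (2 * e)"
      using i2 N.prob_space by simp
    also have "\<dots> < e / 2 + e\<^sup>2 / (2 * e)"
      using sq_less assms by (intro add_strict_left_mono divide_strict_right_mono) auto
    also have "\<dots> = e" using assms by (simp add: power2_eq_square)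
    finally show ?thesis by (simp add: d_def)
  qed
  show ?thesis
  proof (intro exI allI impI)
    fix i j assume "i \<ge> N" "j \<ge> N"
    then show "(LINT t|?N. cmod (fourier (cut (real i)) t - fourier (cut (real j)) t)) < e"
      using *[of i j] *[of j i] by (cases "i \<le> j") (auto simp: norm_minus_commute)
  qed
qed

text \<open>Fatou's lemma along the subsequence turns the bound between two truncations into a bound
  between a truncation and \<open>M\<close>, valid for every \<open>R\<close> and not only along the
  subsequence.\<close>

lemma L2_fourier_limit:
  assumes lim: "\<And>t. t \<in> A \<Longrightarrow> ((\<lambda>R. fourier (cut R) t) \<longlongrightarrow> 0) at_top"
  obtains M where "M \<in> borel_measurable borel"
    "integrable lborel (\<lambda>t. (cmod (M t))\<^sup>2)"
    "\<And>R. integrable lborel (\<lambda>t. (cmod (fourier (cut R) t - M t))\<^sup>2)"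
    "((\<lambda>R. LINT t|lborel. (cmod (fourier (cut R) t - M t))\<^sup>2) \<longlongrightarrow> 0) at_top"
    "\<And>t. t \<in> A \<Longrightarrow> M t = 0"
proof -
  let ?N = std_normal_distribution
  interpret N: real_distribution ?N by (rule real_dist_normal_dist)
  define m where "m n = fourier (cut (real n))" for n
  have [measurable]: "m n \<in> borel_measurable borel" for n
    unfolding m_def by measurable
  have "integrable ?N (m n)" for n
    by (rule N.integrable_const_bound[where B = "LINT s|lborel. cmod (cut (real n) s)"])
       (auto simp: m_def intro!: norm_fourier_le integrable_cut)
  then obtain r where r: "strict_mono r" and Cau: "AE t in ?N. Cauchy (\<lambda>i. m (r i) t)"
    using cauchy_L1_AE_cauchy_subseq[of ?N m] fourier_cut_gaussian_Cauchy unfolding m_def by blast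
  \<comment> \<open>Taking \<open>lim\<close> pointwise makes \<open>M\<close> vanish at every point
    of \<open>A\<close>, since there the whole family tends to 0.\<close>
  define M where "M t = lim (\<lambda>i. m (r i) t)" for t
  have M_meas [measurable]: "M \<in> borel_measurable borel"
    unfolding M_def[abs_def] by (rule borel_measurable_lim_metric) measurable
  \<comment> \<open>The normal density is positive everywhere, so its null sets are Lebesgue null
    sets.\<close>
  have "AE t in lborel. Cauchy (\<lambda>i. m (r i) t)"
    using Cau normal_density_pos[of 1 0]
    by (simp add: AE_density)
  then have M_lim: "AE t in lborel. (\<lambda>i. m (r i) t) \<longlonglongrightarrow> M t"
    by eventually_elim (auto simp: M_def Cauchy_convergent_iff convergent_LIMSEQ_iff)
  have r_top: "filterlim (\<lambda>i. real (r i)) at_top sequentially"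
    by (rule filterlim_compose[OF filterlim_real_sequentially filterlim_subseq[OF r]])
  have bound: "(\<integral>\<^sup>+t. ennreal ((cmod (fourier (cut R) t - M t))\<^sup>2) \<partial>lborel) \<le> ennreal (2 * pi * tail R)" for R
  proof -
    have "AE t in lborel. ennreal ((cmod (fourier (cut R) t - M t))\<^sup>2)
        = liminf (\<lambda>i. ennreal ((cmod (fourier (cut R) t - m (r i) t))\<^sup>2))"
      using M_lim
    proof eventually_elim
      case (elim t)
      have "(\<lambda>i. ennreal ((cmod (fourier (cut R) t - m (r i) t))\<^sup>2)) \<longlonglongrightarrow> ennreal ((cmod (fourier (cut R) t - M t))\<^sup>2)"
        by (intro tendsto_ennrealI tendsto_intros elim)
      then show ?case by (intro lim_imp_Liminf[symmetric]) auto
    qed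
    then have "(\<integral>\<^sup>+t. ennreal ((cmod (fourier (cut R) t - M t))\<^sup>2) \<partial>lborel)
        = (\<integral>\<^sup>+t. liminf (\<lambda>i. ennreal ((cmod (fourier (cut R) t - m (r i) t))\<^sup>2)) \<partial>lborel)"
      by (rule nn_integral_cong_AE)
    also have "\<dots> \<le> liminf (\<lambda>i. \<integral>\<^sup>+t. ennreal ((cmod (fourier (cut R) t - m (r i) t))\<^sup>2) \<partial>lborel)"
      by (rule nn_integral_liminf) measurable
    also have "\<dots> \<le> ennreal (2 * pi * tail R)"
    proof (rule Liminf_le)
      show "\<forall>\<^sub>F i in sequentially. (\<integral>\<^sup>+t. ennreal ((cmod (fourier (cut R) t - m (r i) t))\<^sup>2) \<partial>lborel)
          \<le> ennreal (2 * pi * tail R)"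
        using filterlim_at_top[THEN iffD1, OF r_top, rule_format, of R]
        by eventually_elim (unfold m_def, rule fourier_cut_diff_le)
    qed simp
    finally show ?thesis .
  qed
  have int: "integrable lborel (\<lambda>t. (cmod (fourier (cut R) t - M t))\<^sup>2)" for R
    using le_less_trans[OF bound[of R] ennreal_less_top]
    by (intro integrableI_bounded) auto
  have le: "(LINT t|lborel. (cmod (fourier (cut R) t - M t))\<^sup>2) \<le> 2 * pi * tail R" for R
    using bound[of R] nn_integral_eq_integral[OF int[of R]] by (simp add: tail_nonneg)
  show ?thesis
  proof (rule that[OF M_meas _ int])
    \<comment> \<open>The interval from 1 to -1 is empty, so the distance bound at
      \<open>R = -1\<close> is the square integrability of \<open>M\<close> itself.\<close>
    have "cut (-1) = (\<lambda>_. 0)" by (auto simp: cut_def)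
    then show "integrable lborel (\<lambda>t. (cmod (M t))\<^sup>2)"
      using int[of "-1"] by (simp add: fourier_def)
    have "((\<lambda>R. 2 * pi * tail R) \<longlongrightarrow> 2 * pi * 0) at_top"
      by (intro tendsto_intros tail_tendsto_0)
    then have lim0: "((\<lambda>R. 2 * pi * tail R) \<longlongrightarrow> 0) at_top" by simp
    show "((\<lambda>R. LINT t|lborel. (cmod (fourier (cut R) t - M t))\<^sup>2) \<longlongrightarrow> 0) at_top"
      by (rule tendsto_sandwich[OF always_eventually always_eventually tendsto_const lim0])
         (simp_all add: le)
    show "M t = 0" if "t \<in> A" for t
      using filterlim_compose[OF lim[OF that] r_top] unfolding M_def m_def by (rule limI)
  qed
qed

lemma fourier_cut_eq_integral: "fourier (cut R) t = integral {-R..R} (\<lambda>s. h s * iexp (t * s))"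
proof -
  have "fourier (cut R) t = (LINT s:{-R..R}|lborel. h s * iexp (t * s))"
    by (simp add: fourier_def cut_def set_lebesgue_integral_def)
  also have "\<dots> = integral {-R..R} (\<lambda>s. h s * iexp (t * s))"
    by (intro set_borel_integral_eq_integral borel_integrable_atLeastAtMost' continuous_intros
          continuous_on_subset[OF cont]) auto
  finally show ?thesis .
qed

end

subsection \<open>Entire functions of exponential type\<close>

locale exponential_type_upper =
  fixes F :: "complex \<Rightarrow> complex" and C T t :: real
  assumes hol: "F holomorphic_on UNIV" and t: "t > T"
    and bd: "\<And>w. cmod (F w) \<le> C * exp (T * \<bar>Im w\<bar>)"
begin

text \<open>At height \<open>y\<close> the factor exp (i t w) has modulus
  \<open>exp (- t * y)\<close>, which outweighs the growth of \<open>F\<close> because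
  \<open>t > T\<close>. The bound does not depend on the abscissa \<open>a\<close>.\<close>

lemma vertical_decay:
  assumes "y \<ge> 0"
  shows "cmod (F (Complex a y)) * exp (- t * y) \<le> C * exp (- (t - T) * y)"
proof -
  have "cmod (F (Complex a y)) * exp (- t * y) \<le> C * exp (T * \<bar>y\<bar>) * exp (- t * y)"
    using bd[of "Complex a y"] by (intro mult_right_mono) auto
  also have "\<dots> = C * exp (- (t - T) * y)"
    using assms by (simp add: algebra_simps flip: exp_add)
  finally show ?thesis .
qed

lemma vertical_measurable:
  "(\<lambda>y. cmod (F (Complex a y)) * exp (- t * y)) \<in> borel_measurable borel"
proof -
  have "continuous_on UNIV (\<lambda>y. cmod (F (Complex a y)) * exp (- t * y))"
    unfolding Complex_eq
    by (intro continuous_intros continuous_on_compose2[OF holomorphic_on_imp_continuous_on[OF hol]]) auto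
  then show ?thesis by (rule borel_measurable_continuous_onI)
qed

lemma vertical_majorant:
  "set_integrable lborel {0<..} (\<lambda>y. C * exp (- (t - T) * y))"
  using integrable_I0i_exp_mscale[of "t - T"] t
  by (intro set_integrable_mult_right) (simp add: algebra_simps)

lemma vertical_integrable:
  "set_integrable lborel {0<..} (\<lambda>y. cmod (F (Complex a y)) * exp (- t * y))"
  unfolding set_integrable_def
proof (rule Bochner_Integration.integrable_bound[OF vertical_majorant[unfolded set_integrable_def]])
  show "AE y in lborel. norm (indicator {0<..} y *\<^sub>R (cmod (F (Complex a y)) * exp (- t * y)))
      \<le> norm (indicator {0<..} y *\<^sub>R (C * exp (- (t - T) * y)))"
  proof (rule AE_I2)
    fix y
    show "norm (indicator {0<..} y *\<^sub>R (cmod (F (Complex a y)) * exp (- t * y)))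
      \<le> norm (indicator {0<..} y *\<^sub>R (C * exp (- (t - T) * y)))"
      using order_trans[OF vertical_decay[of y a] abs_ge_self] by (auto simp: indicator_def)
  qed
qed (use vertical_measurable in measurable)

text \<open>This is Cauchy's theorem on a rectangle of height Y, with sides expressed as differences
  of a primitive. For fixed \<open>R\<close> the top side vanishes as Y grows, leaving the two
  vertical sides.\<close>

lemma integral_shift_bound:
  assumes R: "R \<ge> 0"
  shows "cmod (integral {-R..R} (\<lambda>s. F (of_real s) * iexp (t * s)))
     \<le> (LINT y:{0<..}|lborel. cmod (F (Complex R y)) * exp (- t * y))
      + (LINT y:{0<..}|lborel. cmod (F (Complex (-R) y)) * exp (- t * y))"
proof -
  define g where "g w = F w * exp (\<i> * of_real t * w)" for w
  have "g holomorphic_on UNIV"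
    unfolding g_def[abs_def] by (intro holomorphic_intros hol)
  then obtain P where P: "\<And>w. (P has_field_derivative g w) (at w)"
    using holomorphic_convex_primitive'[of UNIV g] by auto
  have norm_g: "cmod (g w) = cmod (F w) * exp (- t * Im w)" for w
    by (simp add: g_def norm_mult norm_exp_eq_Re)
  define D where "D a = (LINT y:{0<..}|lborel. cmod (F (Complex a y)) * exp (- t * y))" for a
  have vert: "cmod (P (Complex a Y) - P (Complex a 0)) \<le> D a" if Y: "Y \<ge> 0" for a Y
  proof -
    let ?h = "\<lambda>y. cmod (F (Complex a y)) * exp (- t * y)"
    have "((\<lambda>y. P (Complex a y)) has_vector_derivative \<i> * g (Complex a y)) (at y within {0..Y})" for y
    proof -
      have "((\<lambda>y. Complex a y) has_vector_derivative \<i>) (at y within {0..Y})"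
        unfolding Complex_eq by (auto intro!: derivative_eq_intros)
      from field_vector_diff_chain_within[OF this has_field_derivative_at_within[OF P]]
      show ?thesis by (simp add: o_def)
    qed
    then have I: "((\<lambda>y. \<i> * g (Complex a y)) has_integral (P (Complex a Y) - P (Complex a 0))) {0..Y}"
      by (intro fundamental_theorem_of_calculus Y)
    have h1: "?h integrable_on {0<..}" and h2: "integral {0<..} ?h = D a"
      using set_borel_integral_eq_integral[OF vertical_integrable[of a]] by (auto simp: D_def)
    have "continuous_on {0..Y} ?h"
      unfolding Complex_eq
      by (intro continuous_intros continuous_on_compose2[OF holomorphic_on_imp_continuous_on[OF hol]]) auto
    then have h3: "?h integrable_on {0..Y}" by (rule integrable_continuous_real)
    \<comment> \<open>Dropping the endpoints makes the interval a subset of \<open>{0<..}\<close>,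
      so monotonicity in the domain applies.\<close>
    then have h4: "(?h has_integral integral {0..Y} ?h) {0<..<Y}"
      by (simp add: has_integral_Icc_iff_Ioo[symmetric] integrable_integral)
    have "cmod (integral {0..Y} (\<lambda>y. \<i> * g (Complex a y))) \<le> integral {0..Y} ?h"
      using I h3 by (intro integral_norm_bound_integral) (auto simp: norm_mult norm_g)
    also have "\<dots> = integral {0<..<Y} ?h"
      using h4 by (simp add: integral_unique)
    also have "\<dots> \<le> integral {0<..} ?h"
      using h1 h4 by (intro integral_subset_le) auto
    finally show ?thesis
      unfolding integral_unique[OF I] h2 .
  qed
  \<comment> \<open>The mean value bound on the horizontal line: the derivative \<open>g\<close> is
    exponentially small there, and the endpoints are \<open>2 * R\<close> apart.\<close>
  have top: "cmod (P (Complex R Y) - P (Complex (-R) Y)) \<le> C * exp (- (t - T) * Y) * (2 * R)"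
    if Y: "Y \<ge> 0" for Y
  proof -
    have "convex {w. Im w = Y}"
      using convex_hyperplane[of \<i> Y] by (simp add: inner_complex_def)
    then have "cmod (P (Complex R Y) - P (Complex (-R) Y))
        \<le> C * exp (- (t - T) * Y) * cmod (Complex R Y - Complex (-R) Y)"
    proof (rule field_differentiable_bound)
      fix w assume "w \<in> {w. Im w = Y}"
      then show "cmod (g w) \<le> C * exp (- (t - T) * Y)"
        using vertical_decay[OF Y, of "Re w"] by (auto simp: norm_g)
    qed (auto intro: has_field_derivative_at_within[OF P])
    moreover have "Complex R Y - Complex (-R) Y = of_real (2 * R)"
      by (simp add: complex_eq_iff)
    ultimately show ?thesis using R by (simp only: norm_of_real)
  qed
  have "((\<lambda>s. P (of_real s)) has_vector_derivative g (of_real s)) (at s within {-R..R})" for s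
  proof -
    have "((\<lambda>s. complex_of_real s) has_vector_derivative 1) (at s within {-R..R})"
      by (auto intro!: derivative_eq_intros)
    from field_vector_diff_chain_within[OF this has_field_derivative_at_within[OF P]]
    show ?thesis by (simp add: o_def)
  qed
  then have "((\<lambda>s. g (of_real s)) has_integral (P (of_real R) - P (of_real (-R)))) {-R..R}"
    by (intro fundamental_theorem_of_calculus) (use R in auto)
  then have "integral {-R..R} (\<lambda>s. g (of_real s)) = P (of_real R) - P (of_real (-R))"
    by (rule integral_unique)
  then have eq: "integral {-R..R} (\<lambda>s. F (of_real s) * iexp (t * s)) = P (Complex R 0) - P (Complex (-R) 0)"
    by (simp only: g_def complex_of_real_def[of R] complex_of_real_def[of "-R"] of_real_mult mult.assoc)
  have bound: "cmod (P (Complex R 0) - P (Complex (-R) 0)) \<le> D R + D (-R) + C * exp (- (t - T) * Y) * (2 * R)"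
    if Y: "Y \<ge> 0" for Y
  proof -
    have "P (Complex R 0) - P (Complex (-R) 0) = (P (Complex R Y) - P (Complex (-R) Y))
        - (P (Complex R Y) - P (Complex R 0)) + (P (Complex (-R) Y) - P (Complex (-R) 0))" by simp
    then show ?thesis
      using vert[OF Y, of R] vert[OF Y, of "-R"] top[OF Y]
      by (smt (verit) norm_triangle_ineq norm_triangle_ineq4)
  qed
  have "((\<lambda>Y. exp (- (t - T) * Y)) \<longlongrightarrow> 0) at_top"
    using t by real_asymp
  then have "((\<lambda>Y. D R + D (-R) + C * exp (- (t - T) * Y) * (2 * R)) \<longlongrightarrow> D R + D (-R) + C * 0 * (2 * R)) at_top"
    by (intro tendsto_intros)
  then have "cmod (P (Complex R 0) - P (Complex (-R) 0)) \<le> D R + D (-R) + C * 0 * (2 * R)"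
    by (rule tendsto_lowerbound) (rule eventually_mono[OF eventually_ge_at_top[of 0] bound], simp_all)
  then show ?thesis by (simp only: eq D_def mult_zero_left mult_zero_right add_0_right)
qed

text \<open>The factor \<open>a\<close> is taken as 1 and -1, so one application of dominated
  convergence serves both sides of the rectangle.\<close>

lemma vertical_integral_tendsto:
  fixes a :: real
  assumes lim: "\<And>y. ((\<lambda>s. F (Complex (a * s) y)) \<longlongrightarrow> 0) at_top"
  shows "((\<lambda>R. LINT y:{0<..}|lborel. cmod (F (Complex (a * R) y)) * exp (- t * y)) \<longlongrightarrow> 0) at_top"
proof -
  have "((\<lambda>R. LINT y|lborel. indicator {0<..} y *\<^sub>R (cmod (F (Complex (a * R) y)) * exp (- t * y)))
      \<longlongrightarrow> (LINT y::real|lborel. (0::real))) at_top"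
  proof (rule integral_dominated_convergence_at_top)
    show "integrable lborel (\<lambda>y. indicator {0<..} y *\<^sub>R (C * exp (- (t - T) * y)))"
      using vertical_majorant by (simp add: set_integrable_def)
    show "AE y in lborel. ((\<lambda>R. indicator {0<..} y *\<^sub>R (cmod (F (Complex (a * R) y)) * exp (- t * y))) \<longlongrightarrow> 0) at_top"
      using lim by (auto intro!: tendsto_eq_intros AE_I2 tendsto_norm_zero)
    show "\<forall>\<^sub>F R in at_top. AE y in lborel. norm (indicator {0<..} y *\<^sub>R (cmod (F (Complex (a * R) y)) * exp (- t * y)))
        \<le> indicator {0<..} y *\<^sub>R (C * exp (- (t - T) * y))"
    proof (intro always_eventually allI AE_I2)
      fix R y
      show "norm (indicator {0<..} y *\<^sub>R (cmod (F (Complex (a * R) y)) * exp (- t * y)))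
        \<le> indicator {0<..} y *\<^sub>R (C * exp (- (t - T) * y))"
        using vertical_decay[of y "a * R"] by (auto simp: indicator_def)
    qed
  qed (use vertical_measurable in measurable)
  then show ?thesis by (simp add: set_lebesgue_integral_def)
qed

lemma truncated_fourier_tendsto_0:
  assumes lim1: "\<And>y. ((\<lambda>s. F (Complex s y)) \<longlongrightarrow> 0) at_top"
    and lim2: "\<And>y. ((\<lambda>s. F (Complex (-s) y)) \<longlongrightarrow> 0) at_top"
  shows "((\<lambda>R. integral {-R..R} (\<lambda>s. F (of_real s) * iexp (t * s))) \<longlongrightarrow> 0) at_top"
proof (rule Lim_null_comparison)
  show "((\<lambda>R. (LINT y:{0<..}|lborel. cmod (F (Complex R y)) * exp (- t * y))
      + (LINT y:{0<..}|lborel. cmod (F (Complex (-R) y)) * exp (- t * y))) \<longlongrightarrow> 0) at_top"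
    using tendsto_add[OF vertical_integral_tendsto[of 1] vertical_integral_tendsto[of "-1"]] lim1 lim2 by simp
qed (use integral_shift_bound in \<open>auto intro: eventually_mono[OF eventually_ge_at_top[of 0]]\<close>)

end

lemma truncated_fourier_tendsto_0:
  fixes F :: "complex \<Rightarrow> complex"
  assumes hol: "F holomorphic_on UNIV" and t: "\<bar>t\<bar> > T"
    and bd: "\<And>w. cmod (F w) \<le> C * exp (T * \<bar>Im w\<bar>)"
    and lim1: "\<And>y. ((\<lambda>s. F (Complex s y)) \<longlongrightarrow> 0) at_top"
    and lim2: "\<And>y. ((\<lambda>s. F (Complex (-s) y)) \<longlongrightarrow> 0) at_top"
  shows "((\<lambda>R. integral {-R..R} (\<lambda>s. F (of_real s) * iexp (t * s))) \<longlongrightarrow> 0) at_top"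
proof (cases "t > T")
  case True
  then interpret exponential_type_upper F C T t
    using hol bd by unfold_locales auto
  show ?thesis by (rule truncated_fourier_tendsto_0[OF lim1 lim2])
next
  case False
  \<comment> \<open>The half turn preserves the growth bound, exchanges the two horizontal ends and
    reverses the sign of \<open>t\<close>. In this case \<open>\<bar>t\<bar> > T\<close> forces
    \<open>- t > T\<close>, so the upward shift applies to \<open>H\<close>.\<close>
  define H where "H w = F (- w)" for w
  have Hol: "H holomorphic_on UNIV"
    using holomorphic_on_compose[OF _ holomorphic_on_subset[OF hol], of uminus UNIV]
    by (simp add: H_def[abs_def] o_def holomorphic_on_minus)
  have H_Complex: "H (Complex a y) = F (Complex (- a) (- y))" for a y
    by (simp add: H_def complex_eq_iff flip: complex_minus)
  interpret exponential_type_upper H C T "- t"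
  proof
    show "cmod (H w) \<le> C * exp (T * \<bar>Im w\<bar>)" for w
      using bd[of "- w"] by (simp add: H_def)
  qed (use Hol t False in auto)
  have "((\<lambda>R. integral {-R..R} (\<lambda>s. H (of_real s) * iexp (- t * s))) \<longlongrightarrow> 0) at_top"
    by (rule truncated_fourier_tendsto_0) (simp_all add: H_Complex lim1 lim2)
  moreover have "integral {-R..R} (\<lambda>s. H (of_real s) * iexp (- t * s))
      = integral {-R..R} (\<lambda>s. F (of_real s) * iexp (t * s))" for R
    using Henstock_Kurzweil_Integration.integral_reflect_real[of R "-R" "\<lambda>s. F (of_real s) * iexp (t * s)"]
    by (simp add: H_def)
  ultimately show ?thesis by simp
qed

subsection \<open>Gluing the branches\<close>

locale log_branches =
  fixes G :: "int \<Rightarrow> complex \<Rightarrow> complex" and gp gm :: "int \<Rightarrow> real \<Rightarrow> complex" and C T :: real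
  assumes G_analytic: "\<And>k. G k analytic_on Omega"
    and gm_eq: "\<And>k x. x > 0 \<Longrightarrow> gm k x = gp (k + 1) x"
    and glued_analytic: "\<And>k x r. x > 0 \<Longrightarrow> 0 < r \<Longrightarrow> r \<le> x \<Longrightarrow> glued G gm k analytic_on ball (of_real x) r"
    and growth: "\<And>k \<theta> r. \<theta> \<in> {0..2*pi} \<Longrightarrow> r > 0 \<Longrightarrow>
        cmod (branch_val G gp gm k r \<theta>) \<le> C * exp (T * \<bar>2 * pi * of_int k + \<theta>\<bar>)"
    and decay_0: "\<And>k. uniform_limit {0..2*pi} (\<lambda>r \<theta>. branch_val G gp gm k r \<theta>) (\<lambda>_. 0) (at_right 0)"
    and decay_top: "\<And>k. uniform_limit {0..2*pi} (\<lambda>r \<theta>. branch_val G gp gm k r \<theta>) (\<lambda>_. 0) at_top"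
begin

definition sheet :: "real \<Rightarrow> int" where
  "sheet y = \<lfloor>y / (2 * pi)\<rfloor>"

text \<open>This is the extension in the coordinate w = log z. The residual angle lies in [0, 2 pi),
  so a seam takes its value from \<open>gp\<close> of the sheet above it, and the case
  \<open>2 * pi\<close> of \<open>branch_val\<close> never occurs.\<close>

definition ext :: "complex \<Rightarrow> complex" where
  "ext w = branch_val G gp gm (sheet (Im w)) (exp (Re w)) (Im w - 2 * pi * of_int (sheet (Im w)))"

lemma sheet_eqI:
  assumes "2 * pi * of_int k \<le> y" "y < 2 * pi * (of_int k + 1)"
  shows "sheet y = k"
  unfolding sheet_def by (rule floor_unique) (use assms in \<open>auto simp: field_simps\<close>)

lemma sheet_bounds: "y - 2 * pi * of_int (sheet y) \<in> {0..<2 * pi}"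
proof -
  have "of_int (sheet y) \<le> y / (2 * pi)" "y / (2 * pi) < of_int (sheet y) + 1"
    unfolding sheet_def by linarith+
  then show ?thesis by (auto simp: field_simps)
qed

lemma ext_strip:
  assumes "2 * pi * of_int k < Im w" "Im w < 2 * pi * (of_int k + 1)"
  shows "ext w = G k (exp w)"
proof -
  have k: "sheet (Im w) = k" using assms by (intro sheet_eqI) auto
  have "cis (Im w - 2 * pi * of_int k) = cis (Im w)"
    by (simp add: cis_multiple_2pi flip: cis_divide)
  then show ?thesis
    using assms by (simp add: ext_def branch_val_def k exp_eq_polar[of w] algebra_simps exp_of_real)
qed

lemma ext_line:
  assumes "Im w = 2 * pi * of_int k"
  shows "ext w = gp k (exp (Re w))"
proof -
  have "sheet (Im w) = k" using assms by (intro sheet_eqI) (auto simp: algebra_simps)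
  then show ?thesis using assms by (simp add: ext_def branch_val_def)
qed

lemma ext_of_real: "ext (of_real s) = gp 0 (exp s)"
  using ext_line[of "of_real s" 0] by simp

lemma exp_in_Omega:
  assumes "2 * pi * of_int k < Im w" "Im w < 2 * pi * (of_int k + 1)"
  shows "exp w \<in> Omega"
proof (rule ccontr)
  assume "exp w \<notin> Omega"
  then obtain r where r: "r \<ge> 0" "exp w = of_real r" by (auto simp: Omega_def)
  with exp_not_eq_zero[of w] have "r > 0" by (cases "r = 0") auto
  then have "exp w = exp (of_real (ln r))" using r by (simp add: exp_of_real)
  then obtain n :: int where "w = of_real (ln r) + (of_int (2 * n) * pi) * \<i>"
    by (auto simp: exp_eq)
  then have "Im w = 2 * pi * of_int n" by simp
  with assms have "2 * pi * of_int k < 2 * pi * of_int n" "2 * pi * of_int n < 2 * pi * of_int (k + 1)"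
    by simp_all
  then have "k < n" "n < k + 1" by (simp_all only: mult_less_cancel_left_pos of_int_less_iff pi_gt_zero zero_less_numeral zero_less_mult_iff simp_thms)
  then show False by simp
qed

text \<open>The line at height 2 pi k separates sheet k - 1 below from sheet k above, hence the
  index \<open>k - 1\<close>. Within distance pi of it, the sign of Im (exp w) is the sign of the
  height above the line, so the cases of \<open>glued\<close> match.\<close>

lemma ext_near_line:
  assumes "\<bar>Im w - 2 * pi * of_int k\<bar> < pi"
  shows "ext w = glued G gm (k - 1) (exp w)"
proof -
  define u where "u = Im w - 2 * pi * of_int k"
  have u: "\<bar>u\<bar> < pi" "Im w = u + 2 * pi * of_int k" using assms by (auto simp: u_def)
  have "cis (Im w) = cis u" unfolding u(2) by (simp add: cis_multiple_2pi flip: cis_mult)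
  then have exp_w: "exp w = of_real (exp (Re w)) * cis u" by (simp add: exp_eq_polar[of w] exp_of_real)
  consider "u = 0" | "u > 0" | "u < 0" by linarith
  then show ?thesis
  proof cases
    case 1
    then have "ext w = gp k (exp (Re w))" using u by (intro ext_line) simp
    then show ?thesis
      using 1 gm_eq[of "exp (Re w)" "k - 1"] by (simp add: glued_def exp_w)
  next
    case 2
    then have "ext w = G k (exp w)" using u by (intro ext_strip) (auto simp: algebra_simps)
    moreover have "Im (exp w) > 0" using 2 u sin_gt_zero[of u] by (simp add: exp_w)
    ultimately show ?thesis by (simp add: glued_def)
  next
    case 3
    then have "ext w = G (k - 1) (exp w)" using u by (intro ext_strip) (auto simp: algebra_simps)
    moreover have "Im (exp w) < 0" using 3 u sin_gt_zero[of "- u"] by (simp add: exp_w mult_less_0_iff)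
    ultimately show ?thesis by (simp add: glued_def)
  qed
qed

lemma ext_holomorphic: "ext holomorphic_on UNIV"
proof -
  have "ext field_differentiable at w" for w
  proof -
    \<comment> \<open>It suffices to write \<open>ext\<close> near \<open>w\<close> as an analytic
      function composed with \<open>exp\<close>: a single branch inside a strip, a glued pair on a
      seam.\<close>
    have *: ?thesis if H: "H analytic_on {exp w}" and ev: "\<forall>\<^sub>F z in nhds w. ext z = H (exp z)" for H
    proof -
      have "H field_differentiable at (exp w)"
        using H by (simp add: analytic_on_imp_differentiable_at)
      then have "(H \<circ> exp) field_differentiable at w"
        by (intro field_differentiable_compose field_differentiable_within_exp)
      then obtain d where "((\<lambda>z. H (exp z)) has_field_derivative d) (at w)"
        by (auto simp: field_differentiable_def o_def)
      then have "(ext has_field_derivative d) (at w)"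
        using DERIV_cong_ev[OF refl ev refl] by simp
      then show ?thesis by (auto simp: field_differentiable_def)
    qed
    define k where "k = sheet (Im w)"
    have k: "2 * pi * of_int k \<le> Im w" "Im w < 2 * pi * (of_int k + 1)"
      using sheet_bounds[of "Im w"] by (auto simp: k_def algebra_simps)
    show ?thesis
    proof (cases "Im w = 2 * pi * of_int k")
      case True
      have "cis (Im w) = 1" unfolding True by (rule cis_multiple_2pi) simp
      then have "exp w = of_real (exp (Re w))" by (simp add: exp_eq_polar[of w] exp_of_real)
      then have "glued G gm (k - 1) analytic_on {exp w}"
        using glued_analytic[of "exp (Re w)" "exp (Re w)" "k - 1"]
        by (auto elim: analytic_on_subset)
      moreover have "\<forall>\<^sub>F z in nhds w. \<bar>Im z - 2 * pi * of_int k\<bar> < pi"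
      proof (rule eventually_nhds_in_open[of "{z. \<bar>Im z - 2 * pi * of_int k\<bar> < pi}", simplified])
        show "open {z. \<bar>Im z - 2 * pi * of_int k\<bar> < pi}"
          by (intro open_Collect_less continuous_intros)
      qed (simp add: True)
      ultimately show ?thesis
        by (intro *[of "glued G gm (k - 1)"]) (auto elim: eventually_mono intro: ext_near_line)
    next
      case False
      then have k': "2 * pi * of_int k < Im w" using k by simp
      have "open {z. 2 * pi * of_int k < Im z \<and> Im z < 2 * pi * (of_int k + 1)}"
        by (intro open_Collect_conj open_Collect_less continuous_intros)
      from eventually_nhds_in_open[OF this, of w]
      have "\<forall>\<^sub>F z in nhds w. 2 * pi * of_int k < Im z \<and> Im z < 2 * pi * (of_int k + 1)"
        using k' k by simp
      moreover have "G k analytic_on {exp w}"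
        using exp_in_Omega[OF k' k(2)] G_analytic[of k] by (auto elim: analytic_on_subset)
      ultimately show ?thesis
        by (intro *[of "G k"]) (auto elim: eventually_mono intro: ext_strip)
    qed
  qed
  then show ?thesis by (simp add: holomorphic_on_def)
qed

text \<open>Sheet and residual angle recombine: 2 pi k + \<theta> is exactly
  \<open>Im w\<close>.\<close>

lemma ext_growth: "cmod (ext w) \<le> C * exp (T * \<bar>Im w\<bar>)"
  using growth[of "Im w - 2 * pi * of_int (sheet (Im w))" "exp (Re w)" "sheet (Im w)"] sheet_bounds[of "Im w"]
  by (simp add: ext_def)

text \<open>Along a horizontal line sheet and angle stay fixed; only the radius \<open>exp s\<close>
  moves.\<close>

lemma ext_tendsto_right: "((\<lambda>s. ext (Complex s y)) \<longlongrightarrow> 0) at_top"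
  unfolding ext_def complex.sel
  by (rule filterlim_compose[OF tendsto_uniform_limitI[OF decay_top] exp_at_top])
     (use sheet_bounds[of y] in auto)

lemma ext_tendsto_left: "((\<lambda>s. ext (Complex (- s) y)) \<longlongrightarrow> 0) at_top"
proof -
  have lim: "filterlim (\<lambda>s. exp (- s) :: real) (at_right 0) at_top" by real_asymp
  show ?thesis
    unfolding ext_def complex.sel
    by (rule filterlim_compose[OF tendsto_uniform_limitI[OF decay_0] lim])
       (use sheet_bounds[of y] in auto)
qed

end

section \<open>The substitution u = exp s, from Mellin to Fourier integrals\<close>

lemma X2_log_square_integrable:
  assumes f: "f \<in> X2 c"
  shows "integrable lebesgue (\<lambda>s. (cmod (of_real (exp s powr c) * f (exp s)))\<^sup>2)"
proof -
  define q where "q x = (cmod (f x * of_real (x powr (c - 1/2))))\<^sup>2" for x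
  have q: "set_integrable lborel {0<..} q"
    using f by (simp add: X2_def q_def[abs_def])
  then have "(\<lambda>x. indicator {0<..} x *\<^sub>R q x) \<in> borel_measurable lborel"
    unfolding set_integrable_def by (rule borel_measurable_integrable)
  with q have "q absolutely_integrable_on {0<..}"
    unfolding set_integrable_def by (subst integrable_completion) auto
  moreover have "exp ` (UNIV :: real set) = {0<..}"
    by (auto simp: image_iff) (metis exp_ln)
  \<comment> \<open>The change of variables is an equivalence that also carries the value of the
    integral; choosing that value as \<open>integral {0<..} q\<close> makes the right-hand side
    immediate.\<close>
  moreover have "((\<lambda>x. \<bar>exp x\<bar> * q (exp x)) absolutely_integrable_on UNIV \<and>
      integral UNIV (\<lambda>x. \<bar>exp x\<bar> * q (exp x)) = integral {0<..} q)
    \<longleftrightarrow> (q absolutely_integrable_on exp ` UNIV \<and> integral (exp ` UNIV) q = integral {0<..} q)"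
    by (rule has_absolute_integral_change_of_variables_1')
       (auto intro!: derivative_eq_intros simp: inj_on_def)
  ultimately have "integrable lebesgue (\<lambda>x. exp x * q (exp x))"
    by (simp add: set_integrable_def)
  moreover have "exp s * q (exp s) = (cmod (of_real (exp s powr c) * f (exp s)))\<^sup>2" for s
  proof -
    \<comment> \<open>The Jacobian \<open>exp s\<close> absorbs the shift by 1/2 in the weight of
      \<open>X2\<close>.\<close>
    have "exp s * (exp s powr (c - 1/2))\<^sup>2 = (exp s powr c)\<^sup>2"
      by (simp add: exp_powr_real power2_eq_square algebra_simps flip: exp_add)
    then show ?thesis
      by (simp add: q_def norm_mult power_mult_distrib algebra_simps)
  qed
  ultimately show ?thesis by simp
qed

text \<open>The Jacobian cancels the -1 in the Mellin exponent, and the interval from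
  \<open>1/\<rho>\<close> to \<open>\<rho>\<close> becomes symmetric about 0 in the logarithmic
  variable.\<close>

lemma mellin_trunc_eq_integral:
  assumes cont: "continuous_on {0<..} f" and \<rho>: "\<rho> \<ge> 1"
  shows "mellin_trunc f c \<rho> t =
    integral {- ln \<rho>..ln \<rho>} (\<lambda>s. of_real (exp s powr c) * f (exp s) * iexp (t * s))"
proof -
  define \<phi> where "\<phi> u = f u * (of_real u) powr (of_real c + \<i> * of_real t - 1)" for u
  have cont\<phi>: "continuous_on {1/\<rho>..\<rho>} \<phi>"
  proof -
    have pos: "{1/\<rho>..\<rho>} \<subseteq> {0<..}"
    proof
      fix x assume "x \<in> {1/\<rho>..\<rho>}"
      moreover have "0 < 1/\<rho>" using \<rho> by simp
      ultimately show "x \<in> {0<..}" using less_le_trans[of 0 "1/\<rho>" x] by simp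
    qed
    then show ?thesis
      unfolding \<phi>_def
      by (intro continuous_intros continuous_on_subset[OF cont]) (auto simp: complex_nonpos_Reals_iff)
  qed
  have eq: "exp s *\<^sub>R \<phi> (exp s) = of_real (exp s powr c) * f (exp s) * iexp (t * s)" for s
  proof -
    have "of_real (exp s) * (of_real (exp s) powr (of_real c + \<i> * of_real t - 1)) = of_real (exp s powr c) * iexp (t * s)"
      by (simp add: powr_def Ln_of_real exp_powr_real exp_of_real[symmetric] algebra_simps flip: exp_add)
    then show ?thesis by (simp add: \<phi>_def scaleR_conv_of_real mult_ac)
  qed
  have exp_ends: "exp (- ln \<rho>) = 1/\<rho>" "exp (ln \<rho>) = \<rho>"
    using \<rho> by (auto simp: exp_minus inverse_eq_divide)
  have ends_le: "1/\<rho> \<le> \<rho>"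
    using \<rho> by (intro order_trans[of "1/\<rho>" 1 \<rho>]) auto
  have "mellin_trunc f c \<rho> t = integral {1/\<rho>..\<rho>} \<phi>"
    unfolding mellin_trunc_def \<phi>_def[symmetric]
    by (intro set_borel_integral_eq_integral borel_integrable_atLeastAtMost' cont\<phi>)
  moreover have "((\<lambda>s. exp s *\<^sub>R \<phi> (exp s)) has_integral integral {exp (- ln \<rho>)..exp (ln \<rho>)} \<phi>) {- ln \<rho>..ln \<rho>}"
  proof (rule has_integral_substitution[where c = "1/\<rho>" and d = \<rho>])
    show "exp ` {- ln \<rho>..ln \<rho>} \<subseteq> {1/\<rho>..\<rho>}"
    proof clarify
      fix s assume "s \<in> {- ln \<rho>..ln \<rho>}"
      then have "exp (- ln \<rho>) \<le> exp s" "exp s \<le> exp (ln \<rho>)" by simp_all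
      then show "exp s \<in> {1/\<rho>..\<rho>}" by (simp only: exp_ends atLeastAtMost_iff)
    qed
  qed (use \<rho> cont\<phi> ends_le in \<open>auto intro!: derivative_eq_intros simp: exp_ends\<close>)
  ultimately show ?thesis by (simp add: exp_ends eq integral_unique)
qed

theorem theorem6:
  fixes c T :: real
  assumes "T > 0"
  shows "MB2 c T \<subseteq> B2 c T"
proof
  fix f assume "f \<in> MB2 c T"
  then show "f \<in> B2 c T"
    unfolding MB2_def mem_Collect_eq
  proof (elim exE conjE)
    fix G gp gm C
    assume X2: "f \<in> X2 c" and MB:
      "\<forall>k. G k analytic_on Omega"
      "\<forall>k. \<forall>x>0. gm k x = gp (k + 1) x"
      "\<forall>x>0. gp 0 x = of_real (x powr c) * f x"
      "\<forall>k. \<forall>x>0. \<forall>r. 0 < r \<and> r \<le> x \<longrightarrow> glued G gm k analytic_on ball (of_real x) r"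
      "\<forall>k. \<forall>\<theta>\<in>{0..2*pi}. \<forall>r>0.
         cmod (branch_val G gp gm k r \<theta>) \<le> C * exp (T * \<bar>2 * pi * of_int k + \<theta>\<bar>)"
      "\<forall>k. uniform_limit {0..2*pi} (\<lambda>r \<theta>. branch_val G gp gm k r \<theta>) (\<lambda>_. 0) (at_right 0)"
      "\<forall>k. uniform_limit {0..2*pi} (\<lambda>r \<theta>. branch_val G gp gm k r \<theta>) (\<lambda>_. 0) at_top"
    interpret log_branches G gp gm C T
      by unfold_locales (use MB in blast)+
    have gp0: "gp 0 x = of_real (x powr c) * f x" if "x > 0" for x
      using MB(3) that by blast
    define h where "h s = ext (of_real s)" for s
    have h_eq: "h s = of_real (exp s powr c) * f (exp s)" for s
      by (simp add: h_def ext_of_real gp0)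
    have h_cont: "continuous_on S h" for S
      unfolding h_def
      by (intro continuous_on_compose2[OF holomorphic_on_imp_continuous_on[OF ext_holomorphic]] continuous_intros) auto
    \<comment> \<open>Membership in \<open>B2\<close> demands continuity of \<open>f\<close>, which
      \<open>X2\<close> does not provide; it is inherited from the entire extension through this
      formula.\<close>
    have f_eq: "f x = of_real (x powr - c) * h (ln x)" if "x > 0" for x
      using that by (simp add: h_eq powr_minus)
    have "continuous_on {0<..} (\<lambda>x. of_real (x powr - c) * h (ln x))"
      by (intro continuous_intros continuous_on_compose2[OF h_cont[of UNIV]]) auto
    then have f_cont: "continuous_on {0<..} f"
      by (rule continuous_on_eq) (simp add: f_eq)
    interpret L2_continuous h
    proof
      have "integrable lebesgue (\<lambda>s. (cmod (h s))\<^sup>2)"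
        using X2_log_square_integrable[OF X2] by (simp add: h_eq)
      \<comment> \<open>The change of variables gave integrability for completed Lebesgue measure;
        continuity of \<open>h\<close> supplies the Borel measurability needed to return to
        \<open>lborel\<close>.\<close>
      moreover have "(\<lambda>s. (cmod (h s))\<^sup>2) \<in> borel_measurable lborel"
        using borel_measurable_continuous_onI[OF h_cont] by simp
      ultimately show "integrable lborel (\<lambda>s. (cmod (h s))\<^sup>2)"
        by (simp add: integrable_completion)
    qed (rule h_cont)
    have trunc: "mellin_trunc f c \<rho> t = fourier (cut (ln \<rho>)) t" if "\<rho> \<ge> 1" for \<rho> t
      using mellin_trunc_eq_integral[OF f_cont that] by (simp add: fourier_cut_eq_integral h_eq)
    have "((\<lambda>R. fourier (cut R) t) \<longlongrightarrow> 0) at_top" if "t \<in> {t. \<bar>t\<bar> > T}" for t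
      unfolding fourier_cut_eq_integral h_def
      by (rule truncated_fourier_tendsto_0[OF ext_holomorphic _ ext_growth ext_tendsto_right ext_tendsto_left])
         (use that in simp)
    from L2_fourier_limit[OF this] obtain M where M:
      "M \<in> borel_measurable borel" "integrable lborel (\<lambda>t. (cmod (M t))\<^sup>2)"
      "\<And>R. integrable lborel (\<lambda>t. (cmod (fourier (cut R) t - M t))\<^sup>2)"
      "((\<lambda>R. LINT t|lborel. (cmod (fourier (cut R) t - M t))\<^sup>2) \<longlongrightarrow> 0) at_top"
      "\<And>t. t \<in> {t. \<bar>t\<bar> > T} \<Longrightarrow> M t = 0" by blast
    \<comment> \<open>Truncations are identified with Fourier integrals for
      \<open>\<rho> \<ge> 1\<close>, which suffices for limits at infinity.\<close>
    have ge1: "\<forall>\<^sub>F \<rho> in at_top. \<rho> \<ge> (1::real)" by (rule eventually_ge_at_top)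
    have "is_mellin_L2 f c M"
      unfolding is_mellin_L2_def
    proof (intro conjI)
      show "\<forall>\<^sub>F \<rho> in at_top. integrable lborel (\<lambda>t. (cmod (mellin_trunc f c \<rho> t - M t))\<^sup>2)"
        using ge1 by eventually_elim (simp add: trunc M)
      have "((\<lambda>\<rho>. LINT t|lborel. (cmod (fourier (cut (ln \<rho>)) t - M t))\<^sup>2) \<longlongrightarrow> 0) at_top"
        by (rule filterlim_compose[OF M(4) ln_at_top])
      then show "((\<lambda>\<rho>. LINT t|lborel. (cmod (mellin_trunc f c \<rho> t - M t))\<^sup>2) \<longlongrightarrow> 0) at_top"
        by (rule Lim_transform_eventually) (use ge1 in \<open>eventually_elim, simp add: trunc\<close>)
    qed (use M in auto)
    then show "f \<in> B2 c T"
      using X2 f_cont M(5) by (auto simp: B2_def)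
  qed
qed

end
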